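(* Let $q$ be a prime and let $l>0$ be an integer. Then for every integer $n$, $$c_{q^l}(n)=q^{l-1}\,c_q\!\left(\frac{n}{q^{l-1}}\right),$$ where $c_q\!\left(\frac{n}{q^{l-1}}\right)$ is understood to be $0$ when $q^{l-1}\nmid n$.
   Context: For a positive integer $q$ and $n\in\mathbb Z$, the Ramanujan sum is $c_q(n)=\sum_{1\le k\le q,\ \gcd(k,q)=1} e^{2\pi i kn/q}$. For a positive integer $m$, the expression $c_q(n/m)$ denotes the interpolated (zero-filled) sequence: it equals the Ramanujan sum $c_q$ at the integer $n/m$ if $m\mid n$, and $0$ otherwise. *)

theory Defs
  imports Complex_Main "HOL-Computational_Algebra.Primes"
begin

definition ramanujan_sum :: "nat \<Rightarrow> int \<Rightarrow> complex" where
  "ramanujan_sum q n =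
     (\<Sum>k \<in> {k \<in> {1..q}. coprime k q}.
        exp (2 * of_real pi * \<i> * of_nat k * of_int n / of_nat q))"

text \<open>
  For \<open>m > 0\<close>, \<open>zero_filled f m n\<close> is the value written \<open>f(n/m)\<close> for the interpolated sequence;
  the integer division is exact in the branch where it is used.
\<close>

definition zero_filled :: "(int \<Rightarrow> complex) \<Rightarrow> nat \<Rightarrow> int \<Rightarrow> complex" where
  "zero_filled f m n = (if int m dvd n then f (n div int m) else 0)"

end

theory Submission
  imports Defs "HOL-Analysis.Complex_Transcendental"
begin

text \<open>
  Modulo $qN$, with $q$ prime and $N = q^{l-1}$, being a unit depends only on the residue modulo
  $q$.  The units modulo $qN$ are therefore the numbers $r + jq$ with $r$ a unit modulo $q$ and
  $0 \le j < N$, and the character splits along this decomposition: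
  \[ e^{2\pi i (r + jq)n/(qN)} = e^{2\pi i rn/(qN)} \, e^{2\pi i jn/N}. \]
  Hence the Ramanujan sum is a product of a sum over $r$ and a sum over $j$.  The latter is a
  complete sum of a character modulo $N$ (lemma \<open>sum_additive_character\<close>): it is $N$ when
  $N \mid n$ and vanishes otherwise.  In the first case the sum over $r$ is exactly the Ramanujan
  sum modulo $q$ at $n/N$.  That units modulo $qN$ are recognised modulo $q$ amounts to every prime
  divisor of $N$ dividing $q$, and lemma \<open>ramanujan_sum_mult_same_primes\<close> is stated for such
  pairs.
\<close>

text \<open>
  The summands are the powers of an $N$-th root of unity $w$.  If \<open>w \<noteq> 1\<close>, their geometric sum
  has the factor $w^N - 1 = 0$.
\<close>

lemma sum_additive_character:
  fixes N :: nat and n :: int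
  assumes "N > 0"
  shows "(\<Sum>j<N. exp (2 * of_real pi * \<i> * of_nat j * of_int n / of_nat N))
       = (if int N dvd n then of_nat N else 0 :: complex)"
proof -
  define w :: complex where "w = exp (2 * of_real pi * \<i> * of_int n / of_nat N)"
  have w_power: "exp (2 * of_real pi * \<i> * of_nat j * of_int n / of_nat N) = w ^ j" for j
    unfolding w_def exp_of_nat_mult [symmetric] by (simp add: mult_ac)
  have w_eq_1: "w = 1 \<longleftrightarrow> int N dvd n"
  proof -
    have "w = 1 \<longleftrightarrow> (\<exists>m::int. 2 * pi * of_int n / of_nat N = of_int (2 * m) * pi)"
      by (simp add: w_def exp_eq_1)
    also have "\<dots> \<longleftrightarrow> (\<exists>m::int. real_of_int n = real_of_int (int N * m))"
      using assms by (intro ex_cong1) (auto simp: field_simps)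
    also have "\<dots> \<longleftrightarrow> int N dvd n"
      unfolding of_int_eq_iff dvd_def ..
    finally show ?thesis .
  qed
  have "w ^ N = exp (2 * of_real pi * \<i> * of_int n)"
    using assms by (simp add: w_def exp_of_nat_mult [symmetric])
  also have "\<dots> = 1"
    by (auto simp: exp_eq_1)
  finally have "w ^ N = 1" .
  then have "(\<Sum>j<N. w ^ j) = (if w = 1 then of_nat N else 0)"
    by (simp add: sum_gp_strict)
  then show ?thesis
    by (simp add: w_power w_eq_1)
qed

text \<open>
  Membership depends only on the residue modulo $q$, so the range is $N$ translated copies of the
  units in one period.  Representatives of residues modulo $q$ are taken in $\{1,\dots,q\}$ to
  match the range in the definition of the Ramanujan sum; this is the reason for the shift by one
  in the inverse map.
\<close>

lemma sum_coprime_split_residues: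
  fixes f :: "nat \<Rightarrow> 'a :: comm_monoid_add"
  assumes "q > 0"
  shows "(\<Sum>k \<in> {k \<in> {1..q * N}. coprime k q}. f k)
       = (\<Sum>r \<in> {r \<in> {1..q}. coprime r q}. \<Sum>j<N. f (r + j * q))"
proof -
  have shift: "coprime (r + j * q) q \<longleftrightarrow> coprime r q" for r j
    by (metis add.commute coprime_iff_gcd_eq_1 gcd.commute gcd_add_mult mult.commute)
  have "(\<Sum>k \<in> {k \<in> {1..q * N}. coprime k q}. f k)
      = (\<Sum>(r, j) \<in> {r \<in> {1..q}. coprime r q} \<times> {..<N}. f (r + j * q))"
  proof (rule sum.reindex_bij_witness
      [where i = "\<lambda>(r, j). r + j * q" and j = "\<lambda>k. ((k - 1) mod q + 1, (k - 1) div q)"])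
    fix k assume k: "k \<in> {k \<in> {1..q * N}. coprime k q}"
    have eq: "(k - 1) mod q + 1 + (k - 1) div q * q = k"
      using k div_mult_mod_eq [of "k - 1" q] by auto
    show "(case ((k - 1) mod q + 1, (k - 1) div q) of (r, j) \<Rightarrow> r + j * q) = k"
      using eq by simp
    have "(k - 1) div q < N"
      using k assms by (auto simp: less_mult_imp_div_less mult.commute)
    moreover have "coprime ((k - 1) mod q + 1) q"
      using k shift [of "(k - 1) mod q + 1" "(k - 1) div q"] eq by simp
    moreover have "(k - 1) mod q + 1 \<le> q"
      using mod_less_divisor [OF assms, of "k - 1"] by linarith
    ultimately show "((k - 1) mod q + 1, (k - 1) div q) \<in> {r \<in> {1..q}. coprime r q} \<times> {..<N}"
      by auto
    show "(case ((k - 1) mod q + 1, (k - 1) div q) of (r, j) \<Rightarrow> f (r + j * q)) = f k"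
      using eq by simp
  next
    fix x assume "x \<in> {r \<in> {1..q}. coprime r q} \<times> {..<N}"
    then obtain r j where x: "x = (r, j)" and r: "1 \<le> r" "r \<le> q" "coprime r q" and j: "j < N"
      by auto
    have pred: "r + j * q - 1 = (r - 1) + j * q" and small: "r - 1 < q"
      using r by auto
    have mod_div: "(r + j * q - 1) mod q = r - 1" "(r + j * q - 1) div q = j"
      unfolding pred by (simp_all only: mod_mult_self1 div_mult_self1 mod_less div_less small assms
          neq0_conv add_0_right)
    show "(\<lambda>k. ((k - 1) mod q + 1, (k - 1) div q)) (case x of (r, j) \<Rightarrow> r + j * q) = x"
      using r mod_div unfolding x by simp
    have "r + j * q \<le> Suc j * q"
      using r by simp
    also have "\<dots> \<le> N * q"
      using j by (intro mult_le_mono1) simp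
    finally show "(case x of (r, j) \<Rightarrow> r + j * q) \<in> {k \<in> {1..q * N}. coprime k q}"
      using r x shift by (simp add: mult.commute)
  qed
  then show ?thesis
    by (simp add: sum.cartesian_product)
qed

text \<open>
  The hypothesis on coprimality says that $q$ and $qN$ have the same prime divisors; it makes the
  range of summation invariant under translation by $q$.
\<close>

lemma ramanujan_sum_mult_same_primes:
  fixes q N :: nat and n :: int
  assumes q: "q > 0" and N: "N > 0"
    and same_primes: "\<And>k. coprime k (q * N) \<longleftrightarrow> coprime k q"
  shows "ramanujan_sum (q * N) n = of_nat N * zero_filled (ramanujan_sum q) N n"
proof -
  let ?U = "{r \<in> {1..q}. coprime r q}"
  let ?e = "\<lambda>k. exp (2 * of_real pi * \<i> * of_nat k * of_int n / of_nat (q * N)) :: complex"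
  let ?c = "\<lambda>j. exp (2 * of_real pi * \<i> * of_nat j * of_int n / of_nat N) :: complex"
  have split: "?e (r + j * q) = ?e r * ?c j" for r j
  proof -
    have "2 * of_real pi * \<i> * of_nat (r + j * q) * of_int n / of_nat (q * N)
        = 2 * of_real pi * \<i> * of_nat r * of_int n / of_nat (q * N)
          + (2 * of_real pi * \<i> * of_nat j * of_int n / of_nat N :: complex)"
      using q N by (simp add: field_simps)
    then show ?thesis
      by (simp only: exp_add)
  qed
  have "ramanujan_sum (q * N) n = (\<Sum>r\<in>?U. \<Sum>j<N. ?e (r + j * q))"
    unfolding ramanujan_sum_def same_primes by (rule sum_coprime_split_residues [OF q])
  also have "\<dots> = (\<Sum>r\<in>?U. ?e r) * (\<Sum>j<N. ?c j)"
    by (simp only: split sum_product)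
  also have "\<dots> = (\<Sum>r\<in>?U. ?e r) * (if int N dvd n then of_nat N else 0)"
    by (simp only: sum_additive_character [OF N])
  also have "\<dots> = of_nat N * zero_filled (ramanujan_sum q) N n"
  proof (cases "int N dvd n")
    case True
    then obtain m where m: "n = int N * m" ..
    have "?e r = exp (2 * of_real pi * \<i> * of_nat r * of_int m / of_nat q)" for r
      using N by (simp add: m mult_ac)
    then show ?thesis
      using N by (simp add: zero_filled_def ramanujan_sum_def m)
  next
    case False
    then show ?thesis
      by (simp add: zero_filled_def)
  qed
  finally show ?thesis .
qed

theorem theorem3p2:
  fixes q l :: nat and n :: int
  assumes "prime q" and "l > 0"
  shows "ramanujan_sum (q ^ l) n
       = of_nat (q ^ (l - 1)) * zero_filled (ramanujan_sum q) (q ^ (l - 1)) n"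
proof -
  have q: "q > 0"
    using assms(1) by (rule prime_gt_0_nat)
  have power: "q ^ l = q * q ^ (l - 1)"
    using assms(2) by (simp add: power_eq_if)
  have "coprime k (q * q ^ (l - 1)) \<longleftrightarrow> coprime k q" for k
    using assms(2) by auto
  then show ?thesis
    unfolding power using q by (intro ramanujan_sum_mult_same_primes) auto
qed

end
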